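(* Let $(\Omega,F)$ and $(\Omega^*,F^* )$ be measurable spaces, let $\eta$ and $\tau$ be probability measures on $(\Omega,F)$, and let $f:\Omega\to\Omega^*$ be a measurable mapping. Let $\eta^*$ and $\tau^*$ be the image measures of $\eta$ and $\tau$ under $f$. If $\eta\ll\tau$, then $\eta^*\ll\tau^*$.
   Context: The image measures on $(\Omega^*,F^* )$ are defined by $\eta^*(E)=\eta(f^{-1}(E))$ and $\tau^*(E)=\tau(f^{-1}(E))$ for $E\in F^*$, where $f^{-1}(E)=\{\omega\in\Omega: f(\omega)\in E\}$. The notation $\eta\ll\tau$ means that $\eta$ is absolutely continuous with respect to $\tau$. *)

theory Defs
  imports "HOL-Probability.Probability"
begin

end

theory Submission
  imports Defs
begin

text \<open>A null set \<open>E\<close> of the image of \<tau> has a \<tau>-null preimage under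
  \<open>f\<close>; this is \<eta>-null by hypothesis, so \<open>E\<close> is null for the image of
  \<eta>. In \<open>absolutely_continuous\<close> the dominating measure comes first.\<close>

theorem theorem3:
  fixes M :: "'a measure" and N :: "'b measure"
    and \<eta> \<tau> :: "'a measure"
    and f :: "'a \<Rightarrow> 'b"
  assumes "prob_space \<eta>" and "sets \<eta> = sets M"
    and "prob_space \<tau>" and "sets \<tau> = sets M"
    and "f \<in> measurable M N"
    and "absolutely_continuous \<tau> \<eta>"
  shows "absolutely_continuous (distr \<tau> N f) (distr \<eta> N f)"
proof -
  have "f \<in> measurable \<tau> N" "f \<in> measurable \<eta> N"
    using assms(2,4,5) measurable_cong_sets by blast+
  \<comment> \<open>\<open>emeasure_distr\<close> cuts each preimage down to the space of its own
    measure; equal spaces make the two preimages the same set.\<close>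
  moreover have "space \<tau> = space \<eta>"
    using assms(2,4) by (metis sets_eq_imp_space_eq)
  moreover have "emeasure \<eta> A = 0" if "A \<in> sets \<tau>" "emeasure \<tau> A = 0" for A
    using assms(6) that unfolding absolutely_continuous_def null_sets_def by blast
  ultimately show ?thesis
    unfolding absolutely_continuous_def null_sets_def
    by (auto simp: emeasure_distr) (metis measurable_sets)
qed

end
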